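(* Let $T$ be a rooted tree with $n>1$ vertices and maximum level $l_{\max}$. Then the multiplicity of $0$ as an eigenvalue of $L(T)$ is at most $n-1-l_{\max}$. If equality holds, then $L(T)$ has only one positive eigenvalue (counted with multiplicity). In particular, equality holds for all rooted paths and all rooted versions of stars (i.e. stars rooted at any of their vertices).
   Context: A rooted tree is a finite tree with a distinguished vertex (the root). The level $l(v)$ of a vertex $v$ is its distance from the root, and $l_{\max}$ is the maximum level of a vertex. For a rooted tree $T$ with vertices $v_1,\dots,v_n$, the level matrix $L(T)=(l_{ij})$ is the $n\times n$ real symmetric matrix with $l_{ij}=|l(v_i)-l(v_j)|$. A rooted path is a path rooted at one of its endvertices. *)

theory Defs
  imports
    "Graph_Theory.Graph_Theory"
    "Jordan_Normal_Form.Char_Poly"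
begin

(* Finite simple undirected graphs are the symmetric, loop-free digraphs without parallel arcs
   of the locale graph. *)

(* The library predicates forest and tree are not usable on symmetric digraphs: there every edge
   {a, b} already gives the cycle a, b, a. The cycles of the undirected graph are those of
   length at least 3. *)
definition undirected_tree :: "('a, 'b) pre_digraph \<Rightarrow> bool" where
  "undirected_tree G \<longleftrightarrow> graph G \<and> Digraph_Component.connected G \<and>
     \<not> (\<exists>p. pre_digraph.cycle G p \<and> 3 \<le> length p)"

definition rooted_tree :: "('a, 'b) pre_digraph \<Rightarrow> 'a \<Rightarrow> bool" where
  "rooted_tree G r \<longleftrightarrow> undirected_tree G \<and> r \<in> verts G"

definition level :: "('a, 'b) pre_digraph \<Rightarrow> 'a \<Rightarrow> 'a \<Rightarrow> nat" where
  "level G r v = (LEAST k. \<exists>p. pre_digraph.awalk G r p v \<and> length p = k)"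

definition max_level :: "('a, 'b) pre_digraph \<Rightarrow> 'a \<Rightarrow> nat" where
  "max_level G r = Max (level G r ` verts G)"

(* vs enumerates the vertices; rows and columns are indexed from 0. *)
definition level_matrix :: "('a, 'b) pre_digraph \<Rightarrow> 'a \<Rightarrow> 'a list \<Rightarrow> real mat" where
  "level_matrix G r vs = mat (length vs) (length vs)
     (\<lambda>(i, j). \<bar>real (level G r (vs ! i)) - real (level G r (vs ! j))\<bar>)"

(* Algebraic multiplicity; it is 0 if x is not an eigenvalue, and it equals the geometric
   multiplicity for real symmetric matrices. *)
definition eigenvalue_multiplicity :: "real mat \<Rightarrow> real \<Rightarrow> nat" where
  "eigenvalue_multiplicity A x = order x (char_poly A)"

definition num_positive_eigenvalues :: "real mat \<Rightarrow> nat" where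
  "num_positive_eigenvalues A =
     (\<Sum>x | eigenvalue A x \<and> x > 0. eigenvalue_multiplicity A x)"

definition path_along :: "('a, 'b) pre_digraph \<Rightarrow> 'a list \<Rightarrow> bool" where
  "path_along G xs \<longleftrightarrow> xs \<noteq> [] \<and> distinct xs \<and> verts G = set xs \<and>
     (\<forall>u v. (u, v) \<in> arcs_ends G \<longleftrightarrow>
        (\<exists>i. Suc i < length xs \<and> {u, v} = {xs ! i, xs ! Suc i}))"

definition rooted_path :: "('a, 'b) pre_digraph \<Rightarrow> 'a \<Rightarrow> bool" where
  "rooted_path G r \<longleftrightarrow> rooted_tree G r \<and>
     (\<exists>xs. path_along G xs \<and> (r = hd xs \<or> r = last xs))"

definition rooted_star :: "('a, 'b) pre_digraph \<Rightarrow> 'a \<Rightarrow> bool" where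
  "rooted_star G r \<longleftrightarrow> rooted_tree G r \<and> (\<exists>m. complete_bipartite_digraph 1 m G)"

end

theory Submission
  imports Defs
begin

text \<open>
  The levels that occur in a rooted tree are exactly \<open>0, \<dots>, M\<close> with \<open>M = l_max\<close>, because every
  prefix of a shortest walk is a shortest walk; and \<open>M \<ge> 1\<close> as soon as there are two vertices. So
  the level matrix is \<open>L = (\<bar>f i - f j\<bar>)\<close> for a map \<open>f\<close> from the \<open>n\<close> indices onto \<open>{0, \<dots>, M}\<close>: it
  is the distance matrix \<open>D\<close> of a path on \<open>M + 1\<close> vertices with rows and columns repeated. All
  claims follow from two facts about such matrices, which determine the multiplicity of \<open>0\<close>
  and the number of positive eigenvalues completely.

  \<^emph>\<open>The rank of \<open>L\<close> is \<open>M + 1\<close>.\<close> The vector \<open>L x\<close> depends only on the \<open>M + 1\<close> sums of \<open>x\<close> over the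
  fibres of \<open>f\<close>, so the rank is at most \<open>M + 1\<close>. It is not smaller, because \<open>D\<close> is injective: the second
  difference of \<open>s \<mapsto> \<bar>s - t\<bar>\<close> is twice the indicator of \<open>t\<close>, hence second differences of \<open>D y\<close>
  recover the inner entries of \<open>y\<close>, and the two outer ones can then be read off at the ends
  (\<open>path_distance_matrix_injective\<close>).

  \<^emph>\<open>\<open>L\<close> has exactly one positive eigenvalue.\<close> The distance \<open>\<bar>f i - f j\<bar>\<close> counts the cuts \<open>t < M\<close> that
  separate \<open>f i\<close> from \<open>f j\<close>, which gives \<open>x\<^sup>T L x = - 2 (\<Sum>t<M. (\<Sum>i | f i \<le> t. x i)\<^sup>2) \<le> 0\<close> on the
  hyperplane of vectors with entry sum \<open>0\<close> (\<open>level_differences_form_on_sum_zero\<close>). A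
  two-dimensional space on which the form is positive definite would meet that hyperplane, so
  there is at most one positive eigenvalue. There is at least one because the trace is \<open>0\<close> and
  \<open>L\<close> is a nonzero symmetric matrix.

  Since multiplicities are orders of roots of the characteristic polynomial, they have
  to be tied to eigenvectors. This is the spectral theorem for real symmetric matrices
  (\<open>real_spectral_theorem\<close>): in an orthonormal eigenbasis both multiplicities become numbers of basis
  vectors (\<open>orthogonal_diagonalisation_multiplicities\<close>), and every dimension count becomes an
  application of \<open>homogeneous_system_nontrivial_solution\<close> to the coefficients of a combination of
  basis vectors.
\<close>

section \<open>Homogeneous linear systems\<close>

text \<open>Gaussian elimination, one equation at a time: an equation with a nonzero coefficient, at \<open>q\<close> say,
  is used to eliminate the unknown \<open>q\<close> from the others, and a solution of the smaller system
  determines the value at \<open>q\<close>.\<close>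

lemma homogeneous_system_nontrivial_solution:
  fixes a :: "'e \<Rightarrow> 'f \<Rightarrow> 'k::field"
  assumes "finite E" "finite F" "card E < card F"
  shows "\<exists>x. (\<exists>k\<in>F. x k \<noteq> 0) \<and> (\<forall>e\<in>E. (\<Sum>k\<in>F. a e k * x k) = 0)"
  using assms
proof (induction E arbitrary: F a rule: finite_induct)
  case empty
  then have "F \<noteq> {}" by auto
  then show ?case by (intro exI[of _ "\<lambda>_. 1"]) auto
next
  case (insert e E)
  show ?case
  proof (cases "\<forall>k\<in>F. a e k = 0")
    case True
    have "card E < card F" using insert.prems insert.hyps by simp
    from insert.IH[OF insert.prems(1) this] obtain x where
      "\<exists>k\<in>F. x k \<noteq> 0" "\<forall>e\<in>E. (\<Sum>k\<in>F. a e k * x k) = 0" by blast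
    with True show ?thesis by (intro exI[of _ x]) auto
  next
    case False
    then obtain q where q: "q \<in> F" "a e q \<noteq> 0" by auto
    define F' where "F' = F - {q}"
    have F: "F = insert q F'" "q \<notin> F'" "finite F'" using q insert.prems by (auto simp: F'_def)
    have "card E < card F'" using insert F by simp
    from insert.IH[OF F(3) this, of "\<lambda>g k. a g k - a g q * a e k / a e q"]
    obtain x where x: "\<exists>k\<in>F'. x k \<noteq> 0"
      and eq: "\<And>g. g \<in> E \<Longrightarrow> (\<Sum>k\<in>F'. (a g k - a g q * a e k / a e q) * x k) = 0" by auto
    define s where "s = (\<Sum>k\<in>F'. a e k * x k)"
    define y where "y = x(q := - s / a e q)"
    have sumy: "(\<Sum>k\<in>F. a g k * y k) = (\<Sum>k\<in>F'. a g k * x k) - a g q * s / a e q" for g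
    proof -
      have "(\<Sum>k\<in>F'. a g k * y k) = (\<Sum>k\<in>F'. a g k * x k)"
        using F(2) by (intro sum.cong) (auto simp: y_def)
      then show ?thesis using F by (simp add: y_def)
    qed
    have "(\<Sum>k\<in>F. a g k * y k) = 0" if "g \<in> insert e E" for g
    proof (cases "g = e")
      case True
      then show ?thesis using q by (simp add: sumy s_def)
    next
      case False
      with that have "0 = (\<Sum>k\<in>F'. (a g k - a g q * a e k / a e q) * x k)" using eq by simp
      also have "\<dots> = (\<Sum>k\<in>F'. a g k * x k) - a g q * s / a e q"
        by (simp add: algebra_simps sum_subtractf s_def sum_distrib_left sum_divide_distrib)
      finally show ?thesis by (simp add: sumy)
    qed
    moreover have "\<exists>k\<in>F. y k \<noteq> 0" using x F by (auto simp: y_def)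
    ultimately show ?thesis by blast
  qed
qed

section \<open>The spectral theorem for real symmetric matrices\<close>

lemma mult_mat_entry:
  assumes "A \<in> carrier_mat n k" "B \<in> carrier_mat k m" "i < n" "j < m"
  shows "(A * B) $$ (i,j) = (\<Sum>l<k. A $$ (i,l) * B $$ (l,j))"
  using assms by (simp add: scalar_prod_def lessThan_atLeast0)

text \<open>Over the complex numbers there is an eigenvalue \<open>z\<close> with an eigenvector \<open>v\<close>. The number
  \<open>Q = v\<^sup>* A v\<close> equals \<open>z \<parallel>v\<parallel>\<^sup>2\<close>, and it is its own conjugate because \<open>A\<close> is real and symmetric; so \<open>z\<close>
  is real.\<close>
lemma symmetric_real_mat_has_eigenvalue:
  fixes A :: "real mat"
  assumes A: "A \<in> carrier_mat n n" and sym: "A\<^sup>T = A" and n: "n > 0"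
  shows "\<exists>e. eigenvalue A e"
proof -
  let ?C = "map_mat complex_of_real A"
  have C: "?C \<in> carrier_mat n n" using A by simp
  from char_poly_factorized[OF C] obtain as where
    as: "char_poly ?C = (\<Prod>a\<leftarrow>as. [:- a, 1:])" "length as = n" by auto
  with n obtain z where "z \<in> set as" by (cases as) auto
  then have "poly (char_poly ?C) z = 0"
    unfolding as poly_prod_list by (auto simp: prod_list_zero_iff)
  then have ev: "eigenvalue ?C z" using eigenvalue_root_char_poly[OF C] by simp
  then obtain v where v: "v \<in> carrier_vec n" "v \<noteq> 0\<^sub>v n" and Cv: "?C *\<^sub>v v = z \<cdot>\<^sub>v v"
    using C by (auto simp: eigenvalue_def eigenvector_def)
  have comp: "(\<Sum>j<n. of_real (A $$ (i,j)) * v $ j) = z * v $ i" if "i < n" for i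
    using arg_cong[OF Cv, of "\<lambda>w. w $ i"] that v A
    by (simp add: scalar_prod_def lessThan_atLeast0)
  have symA: "A $$ (j,i) = A $$ (i,j)" if "i < n" "j < n" for i j
    using arg_cong[OF sym, of "\<lambda>B. B $$ (i,j)"] that A by simp
  define Q where "Q = (\<Sum>i<n. \<Sum>j<n. of_real (A $$ (i,j)) * v $ j * cnj (v $ i))"
  have "Q = (\<Sum>i<n. (\<Sum>j<n. of_real (A $$ (i,j)) * v $ j) * cnj (v $ i))"
    by (simp add: Q_def sum_distrib_right)
  also have "\<dots> = (\<Sum>i<n. z * (v $ i * cnj (v $ i)))"
    by (intro sum.cong) (auto simp: comp)
  also have "\<dots> = z * of_real (\<Sum>i<n. (cmod (v $ i))\<^sup>2)"
    by (simp add: sum_distrib_left complex_norm_square del: of_real_power)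
  finally have Q1: "Q = z * of_real (\<Sum>i<n. (cmod (v $ i))\<^sup>2)" .
  have "cnj Q = (\<Sum>i<n. \<Sum>j<n. of_real (A $$ (i,j)) * cnj (v $ j) * v $ i)"
    by (simp add: Q_def)
  also have "\<dots> = (\<Sum>j<n. \<Sum>i<n. of_real (A $$ (i,j)) * cnj (v $ j) * v $ i)"
    by (rule sum.swap)
  also have "\<dots> = Q"
    unfolding Q_def by (intro sum.cong refl) (auto simp: symA mult_ac)
  finally have Q2: "cnj Q = Q" .
  obtain i where "i < n" "v $ i \<noteq> 0" using v by (metis carrier_vecD eq_vecI index_zero_vec)
  then have "(\<Sum>i<n. (cmod (v $ i))\<^sup>2) > 0"
    by (intro sum_pos2[of _ i]) auto
  moreover define s where "s = (\<Sum>i<n. (cmod (v $ i))\<^sup>2)"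
  ultimately have "s > 0" "Q = z * of_real s" using Q1 by auto
  then have "cnj z = z" using Q2 by auto
  then obtain x where x: "z = of_real x" by (metis Reals_cnj_iff Reals_cases)
  have "eigenvalue A x" using ev
    unfolding eigenvalue_root_char_poly[OF C] eigenvalue_root_char_poly[OF A] x
    by (simp add: of_real_hom.char_poly_hom[OF A])
  then show ?thesis ..
qed

lemma normalised_real_eigenvector:
  fixes A :: "real mat"
  assumes A: "A \<in> carrier_mat n n" and ev: "eigenvalue A e"
  shows "\<exists>v. (\<forall>i<n. (\<Sum>j<n. A $$ (i,j) * v j) = e * v i) \<and> (\<Sum>i<n. (v i)\<^sup>2) = 1"
proof -
  obtain u where u: "u \<in> carrier_vec n" "u \<noteq> 0\<^sub>v n" and Au: "A *\<^sub>v u = e \<cdot>\<^sub>v u"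
    using ev A by (auto simp: eigenvalue_def eigenvector_def)
  have comp: "(\<Sum>j<n. A $$ (i,j) * u $ j) = e * u $ i" if "i < n" for i
    using arg_cong[OF Au, of "\<lambda>w. w $ i"] that u A
    by (simp add: scalar_prod_def lessThan_atLeast0)
  obtain i where i: "i < n" "u $ i \<noteq> 0" using u by (metis carrier_vecD eq_vecI index_zero_vec)
  define s where "s = (\<Sum>i<n. (u $ i)\<^sup>2)"
  have s: "s > 0" unfolding s_def using i by (intro sum_pos2[of _ i]) auto
  define v where "v j = u $ j / sqrt s" for j
  have "(\<Sum>i<n. (v i)\<^sup>2) = 1"
    using s by (simp add: v_def power_divide sum_divide_distrib[symmetric]) (simp add: s_def)
  moreover have "(\<Sum>j<n. A $$ (i,j) * v j) = e * v i" if "i < n" for i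
    using comp[OF that] by (simp add: v_def sum_divide_distrib[symmetric])
  ultimately show ?thesis by blast
qed

text \<open>The reflection that exchanges the unit vectors \<open>e\<^sub>0\<close> and \<open>v\<close>. With \<open>w = v - e\<^sub>0\<close> it is
  \<open>1 - 2 w w\<^sup>T / \<parallel>w\<parallel>\<^sup>2\<close>, where \<open>\<parallel>w\<parallel>\<^sup>2 = 2 (1 - v 0)\<close>. For \<open>v = e\<^sub>0\<close> division by zero yields the identity
  matrix, as it should.\<close>
definition householder :: "nat \<Rightarrow> (nat \<Rightarrow> real) \<Rightarrow> real mat" where
  "householder n v = mat n n (\<lambda>(i,j). (if i = j then 1 else 0) -
     (v i - (if i = 0 then 1 else 0)) * (v j - (if j = 0 then 1 else 0)) / (1 - v 0))"

lemma householder_carrier [simp]: "householder n v \<in> carrier_mat n n"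
  by (simp add: householder_def)

lemma householder_symmetric: "(householder n v)\<^sup>T = householder n v"
  by (auto simp: householder_def mult_ac)

lemma
  fixes v :: "nat \<Rightarrow> real"
  assumes n: "n > 0" and v: "(\<Sum>i<n. (v i)\<^sup>2) = 1"
  shows householder_first_column: "\<And>i. i < n \<Longrightarrow> householder n v $$ (i, 0) = v i"
    and householder_involution: "householder n v * householder n v = 1\<^sub>m n"
proof -
  define w where "w i = v i - (if i = 0 then 1 else 0)" for i :: nat
  have "(\<Sum>i<n. (w i)\<^sup>2) = (\<Sum>i<n. (v i)\<^sup>2 + (if i = 0 then 1 - 2 * v 0 else 0))"
    by (intro sum.cong) (auto simp: w_def power2_eq_square algebra_simps)
  also have "\<dots> = 2 * (1 - v 0)"
    using n by (simp add: sum.distrib v)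
  finally have ww: "(\<Sum>i<n. w i * w i) = 2 * (1 - v 0)" by (simp add: power2_eq_square)
  (* In the degenerate case v = e_0 the numerators vanish as well. *)
  have w0: "w i = 0" if "v 0 = 1" "i < n" for i
  proof -
    have "(\<Sum>i<n. w i * w i) = 0" using ww that by simp
    then show ?thesis using that by (subst (asm) sum_nonneg_eq_0_iff) auto
  qed
  have H: "householder n v = mat n n (\<lambda>(i,j). (if i = j then 1 else 0) - w i * w j / (1 - v 0))"
    by (simp add: householder_def w_def)
  show "householder n v $$ (i, 0) = v i" if "i < n" for i
  proof (cases "v 0 = 1")
    case True
    then show ?thesis using w0[OF True that] that n by (simp add: H) (auto simp: w_def split: if_splits)
  next
    case False
    have "w 0 = - (1 - v 0)" by (simp add: w_def)
    moreover have "1 - v 0 \<noteq> 0" using False by simp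
    ultimately have "w i * w 0 / (1 - v 0) = - w i" by (metis mult_minus_right nonzero_mult_div_cancel_right minus_divide_left)
    then show ?thesis using that n by (auto simp: H w_def)
  qed
  show "householder n v * householder n v = 1\<^sub>m n"
  proof (rule eq_matI)
    fix i j assume "i < dim_row (1\<^sub>m n)" "j < dim_col (1\<^sub>m n)"
    then have ij: "i < n" "j < n" by auto
    (* c = 0 if v 0 = 1; the identity c * (c * (1 - v 0)) = c holds in that case too. *)
    define c where "c = 1 / (1 - v 0)"
    have "(householder n v * householder n v) $$ (i,j) =
       (\<Sum>k<n. ((if i = k then 1 else 0) - c * w i * w k) * ((if k = j then 1 else 0) - c * w k * w j))"
      using ij by (simp add: H scalar_prod_def lessThan_atLeast0 c_def)
    also have "\<dots> = (\<Sum>k<n. (if i = k then (if k = j then 1 else 0) - c * w k * w j else 0)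
        - (if k = j then c * w i * w k else 0) + c * c * w i * w j * (w k * w k))"
      by (intro sum.cong) (auto simp: algebra_simps)
    also have "\<dots> = (if i = j then 1 else 0) - 2 * c * w i * w j + c * c * w i * w j * (2 * (1 - v 0))"
      using ij by (simp add: sum.distrib sum_subtractf sum_distrib_left[symmetric] ww)
    also have "\<dots> = (if i = j then 1 else 0)"
    proof -
      have c: "c * (c * (1 - v 0)) = c" by (simp add: c_def)
      have "c * c * w i * w j * (2 * (1 - v 0)) = 2 * (c * (c * (1 - v 0))) * w i * w j"
        by (simp only: ac_simps)
      also have "\<dots> = 2 * c * w i * w j" by (simp only: c)
      finally have "c * c * w i * w j * (2 * (1 - v 0)) = 2 * c * w i * w j" .
      then show ?thesis by simp
    qed
    finally show "(householder n v * householder n v) $$ (i,j) = 1\<^sub>m n $$ (i,j)" using ij by simp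
  qed (simp_all add: householder_def)
qed

text \<open>Deflation: conjugating with the reflection \<open>H\<close> that takes \<open>e\<^sub>0\<close> to a unit eigenvector of \<open>A\<close>
  turns \<open>e\<^sub>0\<close> into an eigenvector of \<open>B = H A H\<close>. The first column of \<open>B\<close>, and by symmetry its first
  row, vanish off the diagonal, so \<open>B\<close> is block diagonal, and the induction hypothesis diagonalises
  its lower block. A reflection is convenient here because it is its own inverse and transpose.\<close>
theorem real_spectral_theorem:
  fixes A :: "real mat"
  assumes "A \<in> carrier_mat n n" and "A\<^sup>T = A"
  shows "\<exists>P d. P \<in> carrier_mat n n \<and> P\<^sup>T * P = 1\<^sub>m n \<and> A * P = P * mat_diag n d"
  using assms
proof (induction n arbitrary: A)
  case 0
  then show ?case by (intro exI[of _ "1\<^sub>m 0"] exI[of _ "\<lambda>_. 0"]) (auto intro!: eq_matI simp: mat_diag_def)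
next
  case (Suc n)
  let ?N = "Suc n"
  note A = Suc.prems(1)
  obtain e where "eigenvalue A e"
    using symmetric_real_mat_has_eigenvalue[OF Suc.prems] by auto
  from normalised_real_eigenvector[OF A this] obtain v where
    Av: "\<And>i. i < ?N \<Longrightarrow> (\<Sum>j<?N. A $$ (i,j) * v j) = e * v i"
    and v1: "(\<Sum>i<?N. (v i)\<^sup>2) = 1" by auto
  define H where "H = householder ?N v"
  have H: "H \<in> carrier_mat ?N ?N" and HT: "H\<^sup>T = H" and HH: "H * H = 1\<^sub>m ?N"
    and H0: "\<And>i. i < ?N \<Longrightarrow> H $$ (i,0) = v i"
    using householder_involution[OF _ v1] householder_first_column[OF _ v1]
    by (auto simp: H_def householder_symmetric)
  define B where "B = H * (A * H)"
  have B: "B \<in> carrier_mat ?N ?N" using A H by (simp add: B_def)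
  have BT: "B\<^sup>T = B"
    unfolding B_def using A H Suc.prems(2) HT
    by (simp add: transpose_mult[of _ ?N ?N _ ?N] assoc_mult_mat[of _ ?N ?N _ ?N _ ?N])
  have "H * B = H * H * (A * H)"
    unfolding B_def using A H by (intro assoc_mult_mat[symmetric]) auto
  then have HB: "H * B = A * H" using A H by (simp add: HH)
  have AH0: "(A * H) $$ (i,0) = e * H $$ (i,0)" if "i < ?N" for i
    using that A H Av[OF that] H0 by (simp add: scalar_prod_def lessThan_atLeast0)
  have B0: "B $$ (i,0) = (if i = 0 then e else 0)" if i: "i < ?N" for i
  proof -
    have "B $$ (i,0) = (\<Sum>k<?N. H $$ (i,k) * (A * H) $$ (k,0))"
      unfolding B_def using A H i by (intro mult_mat_entry) auto
    also have "\<dots> = e * (\<Sum>k<?N. H $$ (i,k) * H $$ (k,0))"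
      by (simp add: AH0 sum_distrib_left mult_ac del: sum.lessThan_Suc)
    also have "(\<Sum>k<?N. H $$ (i,k) * H $$ (k,0)) = (H * H) $$ (i,0)"
      using H i by (simp add: scalar_prod_def lessThan_atLeast0 del: sum.op_ivl_Suc)
    finally show ?thesis using i by (simp add: HH)
  qed
  have Bsym: "B $$ (0,i) = B $$ (i,0)" if "i < ?N" for i
    using arg_cong[OF BT, of "\<lambda>X. X $$ (i,0)"] B that by simp
  define A' where "A' = mat n n (\<lambda>(i,j). B $$ (Suc i, Suc j))"
  have A': "A' \<in> carrier_mat n n" by (simp add: A'_def)
  have "A'\<^sup>T = A'"
  proof (rule eq_matI)
    fix i j assume "i < dim_row A'" "j < dim_col A'"
    then show "A'\<^sup>T $$ (i,j) = A' $$ (i,j)"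
      using arg_cong[OF BT, of "\<lambda>X. X $$ (Suc i, Suc j)"] B by (simp add: A'_def)
  qed (simp_all add: A'_def)
  from Suc.IH[OF A' this] obtain P d where P: "P \<in> carrier_mat n n"
    and PP: "P\<^sup>T * P = 1\<^sub>m n" and AP: "A' * P = P * mat_diag n d" by blast
  define blk where "blk = (\<lambda>x (M::real mat). four_block_mat (x \<cdot>\<^sub>m 1\<^sub>m 1) (0\<^sub>m 1 n) (0\<^sub>m n 1) M)"
  have blk: "blk x M \<in> carrier_mat ?N ?N" if "M \<in> carrier_mat n n" for x M
    unfolding blk_def using that by (metis four_block_carrier_mat one_carrier_mat plus_1_eq_Suc smult_carrier_mat)
  have blk_mult: "blk x M * blk y K = blk (x * y) (M * K)"
    if "M \<in> carrier_mat n n" "K \<in> carrier_mat n n" for x y M K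
    unfolding blk_def using that
    by (subst mult_four_block_mat[of _ 1 1 _ n _ n _ _ 1 _ n])
       (auto intro!: cong_four_block_mat eq_matI)
  have Bblk: "B = blk e A'"
  proof (rule eq_matI)
    fix i j assume "i < dim_row (blk e A')" "j < dim_col (blk e A')"
    then have "i < ?N" "j < ?N" using blk[OF A', of e] by auto
    then show "B $$ (i,j) = blk e A' $$ (i,j)"
      using Bsym B0 A' by (cases i; cases j) (auto simp: blk_def A'_def)
  qed (use blk[OF A', of e] B in auto)
  define d' where "d' = case_nat e d"
  have Dblk: "mat_diag ?N d' = blk e (mat_diag n d)"
    by (rule eq_matI) (auto simp: blk_def mat_diag_def d'_def split: nat.splits)
  have one_blk: "1\<^sub>m ?N = blk 1 (1\<^sub>m n)"
    by (rule eq_matI) (auto simp: blk_def)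
  define Q where "Q = blk 1 P"
  have Q: "Q \<in> carrier_mat ?N ?N" using blk P by (simp add: Q_def)
  have QT: "Q\<^sup>T = blk 1 P\<^sup>T"
    using P by (intro eq_matI) (auto simp: Q_def blk_def)
  have QQ: "Q\<^sup>T * Q = 1\<^sub>m ?N" unfolding QT using P PP by (simp add: one_blk blk_mult Q_def)
  have BQ: "B * Q = Q * mat_diag ?N d'"
    using P A' AP by (simp add: Bblk Dblk Q_def blk_mult)
  show ?case
  proof (intro exI conjI)
    show "H * Q \<in> carrier_mat ?N ?N" using H Q by simp
    have "(H * Q)\<^sup>T * (H * Q) = Q\<^sup>T * (H * H * Q)"
      using H Q HT by (simp add: transpose_mult[of _ ?N ?N _ ?N] assoc_mult_mat[of _ ?N ?N _ ?N _ ?N])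
    then show "(H * Q)\<^sup>T * (H * Q) = 1\<^sub>m ?N" using Q QQ HH by simp
    have "A * (H * Q) = A * H * Q" using A H Q by (simp add: assoc_mult_mat[of _ ?N ?N _ ?N _ ?N])
    also have "\<dots> = H * (B * Q)" using HB H B Q by (simp add: assoc_mult_mat[of _ ?N ?N _ ?N _ ?N] flip: HB)
    also have "\<dots> = H * Q * mat_diag ?N d'"
      unfolding BQ using H Q by (simp add: assoc_mult_mat[of _ ?N ?N _ ?N _ ?N])
    finally show "A * (H * Q) = H * Q * mat_diag ?N d'" .
  qed
qed

text \<open>\<open>A\<close> is similar to the diagonal matrix, so its characteristic polynomial is the product of the
  factors \<open>X - d k\<close>, and orders of roots count indices. Distinct positive eigenvalues correspond to
  disjoint sets of indices, which together are all indices with \<open>d k > 0\<close>.\<close>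

lemma orthogonal_diagonalisation_multiplicities:
  fixes A P :: "real mat"
  assumes A: "A \<in> carrier_mat n n" and P: "P \<in> carrier_mat n n"
    and PP: "P\<^sup>T * P = 1\<^sub>m n" and AP: "A * P = P * mat_diag n d"
  shows "eigenvalue_multiplicity A x = card {k. k < n \<and> d k = x}"
    and "num_positive_eigenvalues A = card {k. k < n \<and> d k > 0}"
proof -
  have PP': "P * P\<^sup>T = 1\<^sub>m n" using mat_mult_left_right_inverse[OF _ P PP] P by simp
  have "A = A * (P * P\<^sup>T)" using A PP' by simp
  also have "\<dots> = P * mat_diag n d * P\<^sup>T"
    using A P AP by (simp add: assoc_mult_mat[of _ n n _ n _ n, symmetric])
  finally have "similar_mat A (mat_diag n d)"
    using A P PP PP' by (intro similar_matI[of _ _ P "P\<^sup>T" n]) auto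
  then have "char_poly A = char_poly (mat_diag n d)" by (rule char_poly_similar)
  also have "\<dots> = (\<Prod>a\<leftarrow>diag_mat (mat_diag n d). [:- a, 1:])"
    by (rule char_poly_upper_triangular[OF mat_diag_dim]) (auto simp: mat_diag_def)
  also have "diag_mat (mat_diag n d) = map d [0..<n]" 
    by (auto simp: diag_mat_def mat_diag_def)
  finally have cp: "char_poly A = (\<Prod>k<n. [:- d k, 1:])"
    by (simp add: prod.list_conv_set_nth comp_def atLeast0LessThan)
  have mult: "eigenvalue_multiplicity A x = card {k. k < n \<and> d k = x}" for x
  proof -
    have "order x (\<Prod>k\<in>K. [:- d k, 1:]) = card {k\<in>K. d k = x}" if "finite K" for K
      using that
    proof (induction K rule: finite_induct)
      case (insert k K)
      have nz: "(\<Prod>k\<in>K. [:- d k, 1:]) \<noteq> 0" using insert by simp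
      have "{j \<in> insert k K. d j = x} = (if d k = x then insert k {j\<in>K. d j = x} else {j\<in>K. d j = x})"
        by auto
      moreover have "order x [:- d k, 1:] = (if d k = x then 1 else 0)"
        using order_power_n_n[of x 1] by (auto simp: order_0I)
      moreover have "order x (\<Prod>k\<in>insert k K. [:- d k, 1:]) =
          order x [:- d k, 1:] + order x (\<Prod>k\<in>K. [:- d k, 1:])"
        unfolding prod.insert[OF insert.hyps] using nz
        by (intro order_mult) (simp del: mult_pCons_left)
      ultimately show ?case using insert by simp
    qed simp
    from this[of "{..<n}"] show ?thesis by (simp add: eigenvalue_multiplicity_def cp)
  qed
  then show "eigenvalue_multiplicity A x = card {k. k < n \<and> d k = x}" .
  have ev: "eigenvalue A y \<longleftrightarrow> (\<exists>k<n. d k = y)" for y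
    unfolding eigenvalue_root_char_poly[OF A] cp by (auto simp: poly_prod)
  have "{y. eigenvalue A y \<and> y > 0} = d ` {k. k < n \<and> d k > 0}" by (auto simp: ev)
  then have "num_positive_eigenvalues A = (\<Sum>y\<in>d ` {k. k < n \<and> d k > 0}. card {k\<in>{k. k < n \<and> d k > 0}. d k = y})"
    unfolding num_positive_eigenvalues_def mult by (intro sum.cong) (auto intro!: arg_cong[where f = card])
  also have "\<dots> = card {k. k < n \<and> d k > 0}"
    using sum.image_gen[of "{k. k < n \<and> d k > 0}" "\<lambda>_. 1::nat" d] by simp
  finally show "num_positive_eigenvalues A = card {k. k < n \<and> d k > 0}" .
qed

section \<open>Matrices of level differences\<close>

text \<open>Second differences of the vanishing function \<open>g\<close> isolate the entries of \<open>y\<close> strictly between \<open>0\<close>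
  and \<open>M\<close>. Only the outer entries then contribute, and \<open>g 0 = M y M\<close>, \<open>g M = M y 0\<close>.\<close>
lemma path_distance_matrix_injective:
  fixes y :: "nat \<Rightarrow> real"
  assumes M: "M \<ge> 1" and z: "\<And>s. s \<le> M \<Longrightarrow> (\<Sum>t\<le>M. \<bar>real s - real t\<bar> * y t) = 0"
    and t: "t \<le> M"
  shows "y t = 0"
proof -
  define g where "g s = (\<Sum>t\<le>M. \<bar>real s - real t\<bar> * y t)" for s
  have g0: "g s = 0" if "s \<le> M" for s using z[OF that] by (simp add: g_def)
  have inner: "y s = 0" if "0 < s" "s < M" for s
  proof -
    have "g (s + 1) - 2 * g s + g (s - 1) = (\<Sum>t\<le>M. (\<bar>real (s + 1) - real t\<bar>
        - 2 * \<bar>real s - real t\<bar> + \<bar>real (s - 1) - real t\<bar>) * y t)"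
      by (simp add: g_def sum_distrib_left sum.distrib sum_subtractf algebra_simps)
    also have "\<dots> = (\<Sum>t\<le>M. if t = s then 2 * y s else 0)"
      using that by (intro sum.cong) (auto simp: of_nat_diff abs_if)
    finally show ?thesis using g0[of s] g0[of "s + 1"] g0[of "s - 1"] that by simp
  qed
  have ends: "y s = 0 \<or> s = 0 \<or> s = M" if "s \<le> M" for s using inner[of s] that by linarith
  have "g 0 = (\<Sum>t\<le>M. if t = M then real M * y M else 0)"
    unfolding g_def by (intro sum.cong) (auto dest: ends)
  then have "y M = 0" using g0[of 0] M by simp
  have "g M = (\<Sum>t\<le>M. if t = 0 then real M * y 0 else 0)"
    unfolding g_def by (intro sum.cong) (auto dest: ends)
  then have "y 0 = 0" using g0[of M] M by simp
  show ?thesis using inner[of t] \<open>y M = 0\<close> \<open>y 0 = 0\<close> t by (cases "t = 0"; cases "t = M") auto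
qed

text \<open>With the indicators \<open>u t\<close> of the lower sets \<open>{i. f i \<le> t}\<close>, the matrix is the sum of the cut
  matrices \<open>(u t i - u t j)\<^sup>2\<close> over \<open>t < M\<close>. Expanding the square, the two pure terms carry the factor
  \<open>\<Sum>i. x i = 0\<close>, and the mixed term is \<open>- 2\<close> times a square.\<close>
lemma level_differences_form_on_sum_zero:
  fixes f :: "'i \<Rightarrow> nat" and x :: "'i \<Rightarrow> real"
  assumes fin: "finite I" and M: "\<And>i. i \<in> I \<Longrightarrow> f i \<le> M" and S: "(\<Sum>i\<in>I. x i) = 0"
  shows "(\<Sum>i\<in>I. \<Sum>j\<in>I. x i * \<bar>real (f i) - real (f j)\<bar> * x j) \<le> 0"
proof -
  define u where "u t i = (if f i \<le> t then 1 else 0 :: real)" for t i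
  have abs_u: "\<bar>real (f i) - real (f j)\<bar> = (\<Sum>t<M. (u t i - u t j)\<^sup>2)" if "i \<in> I" "j \<in> I" for i j
  proof -
    have *: "real b - real a = (\<Sum>t<M. if a \<le> t \<and> t < b then 1 else 0)" if "a \<le> b" "b \<le> M" for a b
    proof -
      have "{t. t < M \<and> a \<le> t \<and> t < b} = {a..<b}" using that by auto
      then show ?thesis using that by (simp add: sum.If_cases Int_def)
    qed
    show ?thesis
    proof (cases "f i \<le> f j")
      case True
      then have "\<bar>real (f i) - real (f j)\<bar> = real (f j) - real (f i)" by simp
      also have "\<dots> = (\<Sum>t<M. (u t i - u t j)\<^sup>2)"
        unfolding *[OF True M[OF that(2)]] using True by (intro sum.cong) (auto simp: u_def)
      finally show ?thesis .
    next
      case False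
      then have le: "f j \<le> f i" by simp
      then have "\<bar>real (f i) - real (f j)\<bar> = real (f i) - real (f j)" by simp
      also have "\<dots> = (\<Sum>t<M. (u t i - u t j)\<^sup>2)"
        unfolding *[OF le M[OF that(1)]] using le by (intro sum.cong) (auto simp: u_def)
      finally show ?thesis .
    qed
  qed
  have step: "(\<Sum>i\<in>I. \<Sum>j\<in>I. x i * (u t i - u t j)\<^sup>2 * x j) = - 2 * (\<Sum>i\<in>I. u t i * x i)\<^sup>2" for t
  proof -
    have "(\<Sum>i\<in>I. \<Sum>j\<in>I. x i * (u t i - u t j)\<^sup>2 * x j)
      = (\<Sum>i\<in>I. \<Sum>j\<in>I. (x i * (u t i)\<^sup>2) * x j + x i * ((u t j)\<^sup>2 * x j) - 2 * ((u t i * x i) * (u t j * x j)))"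
      by (intro sum.cong refl) (simp add: power2_eq_square algebra_simps)
    also have "\<dots> = (\<Sum>i\<in>I. x i * (u t i)\<^sup>2) * (\<Sum>j\<in>I. x j) + (\<Sum>i\<in>I. x i) * (\<Sum>j\<in>I. (u t j)\<^sup>2 * x j)
        - 2 * ((\<Sum>i\<in>I. u t i * x i) * (\<Sum>j\<in>I. u t j * x j))"
      unfolding sum.distrib sum_subtractf sum_product by (simp add: sum_distrib_left)
    finally show ?thesis by (simp add: S power2_eq_square)
  qed
  have "(\<Sum>i\<in>I. \<Sum>j\<in>I. x i * \<bar>real (f i) - real (f j)\<bar> * x j)
      = (\<Sum>i\<in>I. \<Sum>j\<in>I. \<Sum>t<M. x i * (u t i - u t j)\<^sup>2 * x j)"
    by (intro sum.cong refl) (simp add: abs_u sum_distrib_left sum_distrib_right)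
  also have "\<dots> = (\<Sum>i\<in>I. \<Sum>t<M. \<Sum>j\<in>I. x i * (u t i - u t j)\<^sup>2 * x j)"
    by (intro sum.cong refl sum.swap)
  also have "\<dots> = (\<Sum>t<M. \<Sum>i\<in>I. \<Sum>j\<in>I. x i * (u t i - u t j)\<^sup>2 * x j)"
    by (rule sum.swap)
  also have "\<dots> = (\<Sum>t<M. - 2 * (\<Sum>i\<in>I. u t i * x i)\<^sup>2)"
    by (simp only: step)
  also have "\<dots> \<le> 0" by (intro sum_nonpos) simp
  finally show ?thesis .
qed

lemma sum_by_fibres:
  assumes "finite I" and "\<And>i. i \<in> I \<Longrightarrow> f i \<le> M"
  shows "(\<Sum>i\<in>I. g (f i) * x i) = (\<Sum>t\<le>(M::nat). g t * (\<Sum>i | i \<in> I \<and> f i = t. x i :: real))"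
proof -
  have "(\<Sum>t\<le>M. g t * (\<Sum>i | i \<in> I \<and> f i = t. x i)) = (\<Sum>t\<le>M. \<Sum>i | i \<in> I \<and> f i = t. g (f i) * x i)"
    by (intro sum.cong refl) (simp add: sum_distrib_left)
  also have "\<dots> = (\<Sum>i\<in>I. g (f i) * x i)"
    using assms by (intro sum.group) auto
  finally show ?thesis by simp
qed

text \<open>Everything is counted in an orthonormal eigenbasis \<open>p 0, \<dots>, p (n - 1)\<close> with eigenvalues \<open>d k\<close>.
  The set \<open>N\<close> of indices with \<open>d k \<noteq> 0\<close> has exactly \<open>M + 1\<close> elements and the set \<open>Pos\<close> of indices
  with \<open>d k > 0\<close> has exactly one.\<close>
theorem level_difference_matrix_spectrum:
  fixes f :: "nat \<Rightarrow> nat" and n M :: nat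
  defines "A \<equiv> mat n n (\<lambda>(i,j). \<bar>real (f i) - real (f j)\<bar>)"
  assumes onto: "f ` {..<n} = {..M}" and M: "M \<ge> 1"
  shows "eigenvalue_multiplicity A 0 = n - Suc M"
    and "Suc M \<le> n"
    and "num_positive_eigenvalues A = 1"
proof -
  have A: "A \<in> carrier_mat n n" and "A\<^sup>T = A" by (auto simp: A_def abs_minus_commute)
  from real_spectral_theorem[OF this] obtain P d where P: "P \<in> carrier_mat n n"
    and PP: "P\<^sup>T * P = 1\<^sub>m n" and AP: "A * P = P * mat_diag n d" by blast
  note mult = orthogonal_diagonalisation_multiplicities[OF A P PP AP]
  have fM: "f i \<le> M" if "i < n" for i using onto that by auto
  define l where "l i j = \<bar>real (f i) - real (f j)\<bar>" for i j
  define p where "p k i = P $$ (i,k)" for k i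
  have orth: "(\<Sum>i<n. p k i * p m i) = (if k = m then 1 else 0)" if "k < n" "m < n" for k m
    using arg_cong[OF PP, of "\<lambda>X. X $$ (k,m)"] P that
    by (subst (asm) mult_mat_entry[of _ n n _ n]) (auto simp: p_def)
  have PP': "P * P\<^sup>T = 1\<^sub>m n" using mat_mult_left_right_inverse[OF _ P PP] P by simp
  have orth': "(\<Sum>k<n. p k i * p k j) = (if i = j then 1 else 0)" if "i < n" "j < n" for i j
    using arg_cong[OF PP', of "\<lambda>X. X $$ (i,j)"] P that
    by (subst (asm) mult_mat_entry[of _ n n _ n]) (auto simp: p_def)
  have eig: "(\<Sum>j<n. l i j * p k j) = d k * p k i" if "k < n" "i < n" for k i
  proof -
    have "(\<Sum>j<n. l i j * p k j) = (A * P) $$ (i,k)"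
      using A P that by (subst mult_mat_entry[of _ n n _ n]) (auto simp: A_def l_def p_def)
    also have "\<dots> = p k i * d k"
      unfolding AP mat_diag_mult_right[OF P] using that by (simp add: p_def)
    finally show ?thesis by simp
  qed
  have coefficient: "c m = (\<Sum>i<n. p m i * (\<Sum>k\<in>K. c k * p k i))" if "K \<subseteq> {..<n}" "m \<in> K" for c K m
  proof -
    have "(\<Sum>i<n. p m i * (\<Sum>k\<in>K. c k * p k i)) = (\<Sum>i<n. \<Sum>k\<in>K. c k * (p m i * p k i))"
      by (simp add: sum_distrib_left mult_ac)
    also have "\<dots> = (\<Sum>k\<in>K. c k * (\<Sum>i<n. p m i * p k i))"
      by (subst sum.swap) (simp add: sum_distrib_left)
    also have "\<dots> = (\<Sum>k\<in>K. if m = k then c k else 0)"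
      using that by (intro sum.cong refl) (subst orth; auto)
    also have "\<dots> = c m" using that finite_subset[OF that(1)] by simp
    finally show ?thesis by simp
  qed
  have apply_comb: "(\<Sum>j<n. l i j * (\<Sum>k\<in>K. c k * p k j)) = (\<Sum>k\<in>K. (c k * d k) * p k i)"
    if "K \<subseteq> {..<n}" "i < n" for c K i
  proof -
    have "(\<Sum>j<n. l i j * (\<Sum>k\<in>K. c k * p k j)) = (\<Sum>j<n. \<Sum>k\<in>K. c k * (l i j * p k j))"
      by (simp add: sum_distrib_left mult_ac)
    also have "\<dots> = (\<Sum>k\<in>K. c k * (\<Sum>j<n. l i j * p k j))"
      by (subst sum.swap) (simp add: sum_distrib_left)
    also have "\<dots> = (\<Sum>k\<in>K. (c k * d k) * p k i)"
      using that by (intro sum.cong refl) (subst eig; auto)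
    finally show ?thesis .
  qed
  have fibres: "(\<Sum>j<n. l i j * x j) = (\<Sum>t\<le>M. \<bar>real (f i) - real t\<bar> * (\<Sum>j | j < n \<and> f j = t. x j))" for i x
    using sum_by_fibres[of "{..<n}" f M "\<lambda>t. \<bar>real (f i) - real t\<bar>" x] fM by (simp add: l_def)
  define Z where "Z = {k. k < n \<and> d k = 0}"
  define N where "N = {k. k < n \<and> d k \<noteq> 0}"
  have fin: "finite Z" "finite N" by (simp_all add: Z_def N_def)
  have "Z \<union> N = {..<n}" "Z \<inter> N = {}" by (auto simp: Z_def N_def)
  then have cards: "card Z + card N = n"
    using card_Un_disjoint[OF fin] by simp
  (* Otherwise a nontrivial combination of the p k with k in N has all fibre sums 0. Then L kills
     it, although L is injective on the span of these vectors. *)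
  have upper: "card N \<le> Suc M"
  proof (rule ccontr)
    assume "\<not> card N \<le> Suc M"
    then have "card {..M} < card N" by simp
    from homogeneous_system_nontrivial_solution[OF _ fin(2) this,
        of "\<lambda>t k. \<Sum>i | i < n \<and> f i = t. p k i"]
    obtain c where c: "\<exists>k\<in>N. c k \<noteq> 0"
      and sys: "\<And>t. t \<le> M \<Longrightarrow> (\<Sum>k\<in>N. (\<Sum>i | i < n \<and> f i = t. p k i) * c k) = 0" by auto
    define x where "x i = (\<Sum>k\<in>N. c k * p k i)" for i
    have x0: "(\<Sum>i | i < n \<and> f i = t. x i) = 0" if "t \<le> M" for t
      using sys[OF that] unfolding x_def by (subst sum.swap) (simp add: sum_distrib_left mult_ac)
    have "(\<Sum>k\<in>N. (c k * d k) * p k i) = 0" if "i < n" for i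
    proof -
      have "(\<Sum>k\<in>N. (c k * d k) * p k i) = (\<Sum>j<n. l i j * x j)"
        unfolding x_def using that by (intro apply_comb[symmetric]) (auto simp: N_def)
      also have "\<dots> = 0" unfolding fibres using x0 by simp
      finally show ?thesis .
    qed
    then have "c m * d m = 0" if "m \<in> N" for m
      using coefficient[of N m "\<lambda>k. c k * d k"] that by (auto simp: N_def)
    with c show False by (auto simp: N_def)
  qed
  (* R contains one representative of every level. *)
  have "\<forall>t\<in>{..M}. \<exists>i. i < n \<and> f i = t" using onto by (metis imageE lessThan_iff)
  then obtain rep where rep: "\<And>t. t \<le> M \<Longrightarrow> rep t < n \<and> f (rep t) = t" by (metis atMost_iff)
  define R where "R = rep ` {..M}"
  have R: "R \<subseteq> {..<n}" using rep by (auto simp: R_def)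
  have "inj_on rep {..M}" by (rule inj_on_inverseI[of _ f]) (use rep in auto)
  then have cardR: "card R = Suc M" by (simp add: R_def card_image)
  show "Suc M \<le> n" using card_mono[OF _ R] cardR by simp
  (* Otherwise the kernel, spanned by the p k with k in Z, contains a nonzero vector supported on
     R: there are n - (M + 1) conditions and more unknowns. Its fibre sums are its entries on R, so
     the path distance matrix kills the vector of these entries. *)
  have lower: "Suc M \<le> card N"
  proof (rule ccontr)
    assume "\<not> Suc M \<le> card N"
    then have "card ({..<n} - R) < card Z"
      using cards cardR R card_mono[OF _ R] by (simp add: card_Diff_subset finite_subset)
    from homogeneous_system_nontrivial_solution[OF _ fin(1) this, of "\<lambda>i k. p k i"]
    obtain c where c: "\<exists>k\<in>Z. c k \<noteq> 0"
      and sys: "\<And>i. i < n \<Longrightarrow> i \<notin> R \<Longrightarrow> (\<Sum>k\<in>Z. p k i * c k) = 0" by auto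
    define x where "x i = (\<Sum>k\<in>Z. c k * p k i)" for i
    have xR: "x i = 0" if "i < n" "i \<notin> R" for i using sys[OF that] by (simp add: x_def mult_ac)
    have fib: "(\<Sum>j | j < n \<and> f j = t. x j) = x (rep t)" if "t \<le> M" for t
    proof -
      have "(\<Sum>j | j < n \<and> f j = t. x j) = (\<Sum>j\<in>{rep t}. x j)"
        using that rep xR by (intro sum.mono_neutral_right) (force simp: R_def)+
      then show ?thesis by simp
    qed
    have "(\<Sum>t\<le>M. \<bar>real s - real t\<bar> * x (rep t)) = 0" if "s \<le> M" for s
    proof -
      have "(\<Sum>t\<le>M. \<bar>real s - real t\<bar> * x (rep t)) = (\<Sum>j<n. l (rep s) j * x j)"
        unfolding fibres using rep[OF that] fib by simp
      also have "\<dots> = (\<Sum>k\<in>Z. (c k * d k) * p k (rep s))"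
        unfolding x_def using rep[OF that] by (intro apply_comb) (auto simp: Z_def)
      also have "\<dots> = 0" by (intro sum.neutral) (auto simp: Z_def)
      finally show ?thesis .
    qed
    then have "x (rep t) = 0" if "t \<le> M" for t
      using path_distance_matrix_injective[OF M, of "\<lambda>t. x (rep t)"] that by blast
    then have "x i = 0" if "i < n" for i using xR that by (auto simp: R_def)
    then have "c m = 0" if "m \<in> Z" for m
      using coefficient[of Z m c] that by (auto simp: Z_def x_def)
    with c show False by blast
  qed
  show "eigenvalue_multiplicity A 0 = n - Suc M"
    using upper lower cards by (simp add: mult Z_def)

  (* The quadratic form of L. *)
  define Q where "Q x = (\<Sum>i<n. \<Sum>j<n. x i * l i j * x j)" for x
  have Q_alt: "Q x = (\<Sum>i<n. x i * (\<Sum>j<n. l i j * x j))" for x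
    by (simp add: Q_def sum_distrib_left mult_ac)
  have Q_neg: "Q x \<le> 0" if "(\<Sum>i<n. x i) = 0" for x
    unfolding Q_def l_def using fM that by (intro level_differences_form_on_sum_zero[of _ f M]) auto
  have Q_comb: "Q (\<lambda>i. \<Sum>k\<in>K. c k * p k i) = (\<Sum>k\<in>K. (c k)\<^sup>2 * d k)" if K: "K \<subseteq> {..<n}" for K c
  proof -
    have "Q (\<lambda>i. \<Sum>k\<in>K. c k * p k i) = (\<Sum>i<n. (\<Sum>k\<in>K. c k * p k i) * (\<Sum>m\<in>K. (c m * d m) * p m i))"
      unfolding Q_alt using K by (simp add: apply_comb)
    also have "\<dots> = (\<Sum>i<n. \<Sum>k\<in>K. c k * (p k i * (\<Sum>m\<in>K. (c m * d m) * p m i)))"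
      by (simp add: sum_distrib_right mult_ac)
    also have "\<dots> = (\<Sum>k\<in>K. c k * (\<Sum>i<n. p k i * (\<Sum>m\<in>K. (c m * d m) * p m i)))"
      by (subst sum.swap) (simp add: sum_distrib_left)
    also have "\<dots> = (\<Sum>k\<in>K. c k * (c k * d k))"
      by (intro sum.cong refl) (simp add: coefficient[OF K, where c = "\<lambda>k. c k * d k", symmetric])
    finally show ?thesis by (simp add: power2_eq_square mult_ac)
  qed
  define Pos where "Pos = {k. k < n \<and> d k > 0}"
  (* Two positive eigenvectors have a nontrivial combination with entry sum 0, a single linear
     condition; the form is positive there by Q_comb and nonpositive by Q_neg. *)
  have "card Pos \<le> 1"
  proof (rule ccontr)
    assume "\<not> card Pos \<le> 1"
    then have K: "Pos \<subseteq> {..<n}" "finite Pos" "card {()} < card Pos"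
      by (auto simp: Pos_def)
    from homogeneous_system_nontrivial_solution[OF _ K(2,3), of "\<lambda>_ k. \<Sum>i<n. p k i"]
    obtain c where c: "\<exists>k\<in>Pos. c k \<noteq> 0" and sys: "(\<Sum>k\<in>Pos. (\<Sum>i<n. p k i) * c k) = 0" by auto
    have "(\<Sum>i<n. \<Sum>k\<in>Pos. c k * p k i) = 0"
      using sys by (subst sum.swap) (simp add: sum_distrib_left mult_ac)
    then have "(\<Sum>k\<in>Pos. (c k)\<^sup>2 * d k) \<le> 0" using Q_neg Q_comb[OF K(1)] by metis
    moreover obtain k where "k \<in> Pos" "c k \<noteq> 0" using c by blast
    then have "(\<Sum>k\<in>Pos. (c k)\<^sup>2 * d k) > 0"
      using K by (intro sum_pos2[of _ k]) (auto simp: Pos_def intro!: mult_nonneg_nonneg less_imp_le)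
    ultimately show False by simp
  qed
  moreover have "Pos \<noteq> {}"
  proof
    assume "Pos = {}"
    then have d0: "d k \<le> 0" if "k < n" for k using that by (force simp: Pos_def)
    (* The sum of the eigenvalues is the trace of L, which is 0. If no eigenvalue is positive, all
       of them are 0, contrary to the rank being M + 1. *)
    have "(\<Sum>k<n. d k) = (\<Sum>k<n. \<Sum>i<n. p k i * (\<Sum>j<n. l i j * p k j))"
    proof (intro sum.cong refl)
      fix k assume k: "k \<in> {..<n}"
      have "d k = d k * (\<Sum>i<n. p k i * p k i)" using k by (simp add: orth)
      also have "\<dots> = (\<Sum>i<n. p k i * (d k * p k i))" by (simp add: sum_distrib_left mult_ac)
      also have "\<dots> = (\<Sum>i<n. p k i * (\<Sum>j<n. l i j * p k j))"
        using k by (intro sum.cong refl) (simp add: eig)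
      finally show "d k = (\<Sum>i<n. p k i * (\<Sum>j<n. l i j * p k j))" .
    qed
    also have "\<dots> = (\<Sum>k<n. \<Sum>i<n. \<Sum>j<n. l i j * (p k i * p k j))"
      by (simp add: sum_distrib_left mult_ac)
    also have "\<dots> = (\<Sum>i<n. \<Sum>k<n. \<Sum>j<n. l i j * (p k i * p k j))"
      by (rule sum.swap)
    also have "\<dots> = (\<Sum>i<n. \<Sum>j<n. \<Sum>k<n. l i j * (p k i * p k j))"
      by (intro sum.cong refl sum.swap)
    also have "\<dots> = (\<Sum>i<n. \<Sum>j<n. l i j * (\<Sum>k<n. p k i * p k j))"
      by (simp add: sum_distrib_left)
    also have "\<dots> = 0"
      by (intro sum.neutral ballI) (simp add: orth' l_def)
    finally have "(\<Sum>k<n. - d k) = 0" by (simp add: sum_negf)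
    then have "d k = 0" if "k < n" for k
      using d0 that by (subst (asm) sum_nonneg_eq_0_iff) auto
    then have "N = {}" by (auto simp: N_def)
    with lower show False by simp
  qed
  ultimately show "num_positive_eigenvalues A = 1"
    unfolding mult Pos_def[symmetric]
    by (metis One_nat_def Suc_leI card_gt_0_iff finite_Collect_conjI finite_Collect_less_nat le_antisym Pos_def)
qed

section \<open>Levels in rooted trees\<close>

context wf_digraph begin

lemma level_le_awalk_length: "awalk r p v \<Longrightarrow> level G r v \<le> length p"
  unfolding level_def by (rule Least_le) blast

lemma obtain_shortest_awalk:
  assumes "r \<rightarrow>\<^sup>* v"
  obtains p where "awalk r p v" "length p = level G r v"
proof -
  have "\<exists>k p. awalk r p v \<and> length p = k" using assms by (auto simp: reachable_awalk)
  then have "\<exists>p. awalk r p v \<and> length p = level G r v"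
    unfolding level_def by (rule LeastI_ex)
  with that show ?thesis by blast
qed

text \<open>Cut a shortest walk to \<open>v\<close> after \<open>t\<close> arcs, at \<open>u\<close>. A shorter walk to \<open>u\<close>, continued by the remaining
  arcs, would be a shorter walk to \<open>v\<close>; so \<open>u\<close> has level exactly \<open>t\<close>.\<close>
lemma level_attained_below:
  assumes "r \<rightarrow>\<^sup>* v" "t \<le> level G r v"
  shows "\<exists>u\<in>verts G. level G r u = t"
proof -
  obtain p where p: "awalk r p v" "length p = level G r v" using obtain_shortest_awalk assms by blast
  define u where "u = awlast r (take t p)"
  have tk: "awalk r (take t p) u" and dr: "awalk u (drop t p) v"
    using p(1) awalk_append_iff[of r "take t p" "drop t p" v] by (auto simp: u_def)
  then have "r \<rightarrow>\<^sup>* u" by (auto simp: reachable_awalk)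
  then obtain q where q: "awalk r q u" "length q = level G r u" using obtain_shortest_awalk by blast
  have "awalk r (q @ drop t p) v" using q(1) dr by (rule awalk_appendI)
  from level_le_awalk_length[OF this] have "t \<le> level G r u" using p(2) q(2) assms(2) by simp
  moreover have "level G r u \<le> t" using level_le_awalk_length[OF tk] by simp
  ultimately show ?thesis using awalk_last_in_verts[OF tk] by auto
qed

end

lemma levels_of_rooted_tree:
  assumes "rooted_tree G r" and "card (verts G) > 1"
  shows "level G r ` verts G = {..max_level G r}" and "max_level G r \<ge> 1"
proof -
  interpret graph G using assms by (simp add: rooted_tree_def undirected_tree_def)
  have r: "r \<in> verts G" and con: "Digraph_Component.connected G"
    using assms by (auto simp: rooted_tree_def undirected_tree_def)
  have "strongly_connected G"
    using con sym_arcs by (rule symmetric_connected_imp_strongly_connected[rotated])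
  then have reach: "r \<rightarrow>\<^sup>*\<^bsub>G\<^esub> v" if "v \<in> verts G" for v using that r by auto
  have le: "level G r v \<le> max_level G r" if "v \<in> verts G" for v
    using that by (simp add: max_level_def)
  have "max_level G r \<in> level G r ` verts G" unfolding max_level_def using r by (intro Max_in) auto
  then obtain w where w: "w \<in> verts G" "level G r w = max_level G r" by auto
  show "level G r ` verts G = {..max_level G r}"
    using le level_attained_below[OF reach[OF w(1)]] by (auto simp: w(2))
  have "verts G \<noteq> {r}" using assms(2) by auto
  then obtain v where v: "v \<in> verts G" "v \<noteq> r" using r by auto
  obtain p where "awalk r p v" "length p = level G r v" using obtain_shortest_awalk[OF reach[OF v(1)]] .
  then have "level G r v \<noteq> 0" using v(2) by (cases p) (auto simp: awalk_Nil_iff)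
  then show "max_level G r \<ge> 1" using le[OF v(1)] by simp
qed

theorem theorem10:
  fixes G :: "('a, 'b) pre_digraph" and r :: 'a and vs :: "'a list" and n :: nat
  assumes "rooted_tree G r"
    and "distinct vs" and "set vs = verts G"
    and "n = card (verts G)" and "n > 1"
  shows
    "int (eigenvalue_multiplicity (level_matrix G r vs) 0) \<le> int n - 1 - int (max_level G r) \<and>
     (int (eigenvalue_multiplicity (level_matrix G r vs) 0) = int n - 1 - int (max_level G r) \<longrightarrow>
        num_positive_eigenvalues (level_matrix G r vs) = 1) \<and>
     (rooted_path G r \<or> rooted_star G r \<longrightarrow>
        int (eigenvalue_multiplicity (level_matrix G r vs) 0) = int n - 1 - int (max_level G r))"
proof -
  let ?f = "\<lambda>i. level G r (vs ! i)"
  have len: "length vs = n" using assms distinct_card by metis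
  have "?f ` {..<n} = level G r ` set vs"
    unfolding len[symmetric] by (auto simp: set_conv_nth)
  then have onto: "?f ` {..<n} = {..max_level G r}"
    using levels_of_rooted_tree(1)[OF assms(1)] assms by simp
  have "max_level G r \<ge> 1" using levels_of_rooted_tree(2)[OF assms(1)] assms by simp
  note spec = level_difference_matrix_spectrum[OF onto this]
  show ?thesis using spec unfolding level_matrix_def len by (auto simp: of_nat_diff)
qed

end
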